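(* Let $E(n,m)$ denote the Euler numbers of the second kind and let $S(n,k)$ denote the Stirling numbers of the second kind. For all integers $n\ge 1$ and $m\ge 0$, both of the following formulas hold: $$E(n,m)=\sum_{k=0}^{m}(-1)^{m-k}\binom{2n+1}{m-k}S(n+k,k),$$ $$E(n,m)=\sum_{k=0}^{m}(-1)^{m-k}\,k\,\binom{2n}{m-k}S(n+k-1,k).$$
   Context: The Euler numbers of the second kind $E(n,m)$ (second-order Eulerian numbers, indexed so that the triangle begins with $E(1,1)=1$, OEIS A008517) are defined for integers $n\ge 0$ and $m\in\mathbb{Z}$ by $E(0,0)=1$, $E(0,m)=0$ for $m\ne 0$, and, for $n\ge 1$, $$E(n,m)=m\,E(n-1,m)+(2n-m)\,E(n-1,m-1).$$ In particular $E(1,1)=1$, $E(1,m)=0$ for $m\neq 1$, and for $n\ge1$, $E(n,m)=0$ unless $1\le m\le n$. The Stirling numbers of the second kind $S(n,k)$, for integers $n,k\ge 0$, count the partitions of an $n$-element set into $k$ nonempty blocks, with $S(0,0)=1$; they satisfy $S(n,k)=k\,S(n-1,k)+S(n-1,k-1)$. *)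

theory Defs
  imports "HOL-Combinatorics.Stirling"
begin

primrec euler2 :: "nat \<Rightarrow> int \<Rightarrow> int" where
  "euler2 0 m = (if m = 0 then 1 else 0)"
| "euler2 (Suc n) m = m * euler2 n m + (2 * int (Suc n) - m) * euler2 n (m - 1)"

lemma euler2_rec:
  "n \<ge> 1 \<Longrightarrow> euler2 n m = m * euler2 (n - 1) m + (2 * int n - m) * euler2 (n - 1) (m - 1)"
  by (cases n) simp_all

lemma euler2_1: "euler2 1 m = (if m = 1 then 1 else 0)"
  by simp

lemma euler2_eq_0:
  "n \<ge> 1 \<Longrightarrow> \<not> (1 \<le> m \<and> m \<le> int n) \<Longrightarrow> euler2 n m = 0"
proof (induction n arbitrary: m rule: nat_induct_at_least)
  case base
  then show ?case by auto
next
  case (Suc n)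
  have "euler2 n m = 0" using Suc.IH[of m] Suc.prems by auto
  moreover have "euler2 n (m - 1) = 0" using Suc.IH[of "m - 1"] Suc.prems by auto
  ultimately show ?case by simp
qed

end

theory Submission
  imports Defs "HOL-Computational_Algebra.Formal_Power_Series"
begin

unbundle fps_syntax

text \<open>
  Both formulas are coefficient extractions from power series identities. Put
  \<open>A\<^sub>n = \<Sum>\<^sub>k S(n+k,k) X\<^sup>k\<close> and \<open>P\<^sub>n = \<Sum>\<^sub>m E(n,m) X\<^sup>m\<close>. The recurrence of the Stirling
  numbers says \<open>(1-X) A\<^sub>n\<^sub>+\<^sub>1 = X A\<^sub>n'\<close> (\<open>stirling2_diag_fps_Suc\<close>), and that of the Euler
  numbers says \<open>P\<^sub>n\<^sub>+\<^sub>1 = X (1-X) P\<^sub>n' + (2n+1) X P\<^sub>n\<close> (\<open>euler2_fps_Suc\<close>). By the product rule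
  the series \<open>(1-X)\<^bsup>2n+1\<^esup> A\<^sub>n\<close> satisfy the latter recurrence as well, and for \<open>n = 0\<close> the
  geometric series gives \<open>(1-X) A\<^sub>0 = 1 = P\<^sub>0\<close>; hence \<open>P\<^sub>n = (1-X)\<^bsup>2n+1\<^esup> A\<^sub>n\<close>
  (\<open>euler2_fps_eq\<close>). By the binomial
  theorem this is the first formula. Absorbing one factor \<open>1-X\<close> into \<open>A\<^sub>n\<close>
  turns it into \<open>P\<^sub>n = (1-X)\<^bsup>2n\<^esup> X A\<^sub>n\<^sub>-\<^sub>1'\<close>, which is the second one.
\<close>

text \<open>
  The generating function of a diagonal of the triangle of Stirling numbers of the second kind.
\<close>
definition stirling2_diag_fps :: "nat \<Rightarrow> int fps" where
  "stirling2_diag_fps n = Abs_fps (\<lambda>k. int (Stirling (n + k) k))"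

text \<open>
  The generating function of a row of the triangle of Euler numbers of the second kind. Only
  indices \<open>m \<ge> 0\<close> are recorded; the row vanishes at all others.
\<close>
definition euler2_fps :: "nat \<Rightarrow> int fps" where
  "euler2_fps n = Abs_fps (\<lambda>m. euler2 n (int m))"

lemma stirling2_diag_fps_0: "(1 - fps_X) * stirling2_diag_fps 0 = 1"
proof (rule fps_ext)
  fix k
  show "((1 - fps_X) * stirling2_diag_fps 0) $ k = (1 :: int fps) $ k"
    by (cases k) (simp_all add: stirling2_diag_fps_def algebra_simps)
qed

lemma stirling2_diag_fps_Suc:
  "(1 - fps_X) * stirling2_diag_fps (Suc n) = fps_X * fps_deriv (stirling2_diag_fps n)"
proof (rule fps_ext)
  fix k
  show "((1 - fps_X) * stirling2_diag_fps (Suc n)) $ k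
      = (fps_X * fps_deriv (stirling2_diag_fps n)) $ k"
    by (cases k) (simp_all add: stirling2_diag_fps_def algebra_simps)
qed

lemma euler2_minus_1: "euler2 n (- 1) = 0"
  by (cases n) (simp_all add: euler2_eq_0 del: euler2.simps(2))

lemma euler2_fps_Suc:
  "euler2_fps (Suc n) = fps_X * (1 - fps_X) * fps_deriv (euler2_fps n)
     + fps_const (of_nat (2 * n + 1)) * fps_X * euler2_fps n"
proof (rule fps_ext)
  fix m
  show "euler2_fps (Suc n) $ m = (fps_X * (1 - fps_X) * fps_deriv (euler2_fps n)
     + fps_const (of_nat (2 * n + 1)) * fps_X * euler2_fps n) $ m"
  proof (cases m)
    case 0
    then show ?thesis by (simp add: euler2_fps_def euler2_minus_1 mult.assoc)
  next
    case (Suc j)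
    have "(fps_X * (1 - fps_X) * fps_deriv (euler2_fps n)) $ Suc j
        = int (Suc j) * euler2 n (int (Suc j)) - int j * euler2 n (int j)"
      by (cases j) (simp_all add: euler2_fps_def algebra_simps)
    moreover have "(fps_const (of_nat (2 * n + 1)) * fps_X * euler2_fps n) $ Suc j
        = int (2 * n + 1) * euler2 n (int j)"
      by (simp add: euler2_fps_def mult.assoc)
    ultimately show ?thesis
      unfolding Suc by (simp add: euler2_fps_def algebra_simps)
  qed
qed

lemma euler2_fps_eq: "euler2_fps n = (1 - fps_X) ^ (2 * n + 1) * stirling2_diag_fps n"
proof (induction n)
  case 0
  have "euler2_fps 0 = 1"
    by (rule fps_ext) (simp add: euler2_fps_def)
  then show ?case by (simp add: stirling2_diag_fps_0)
next
  case (Suc n)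
  define u :: "int fps" where "u = 1 - fps_X"
  define A where "A = stirling2_diag_fps n"
  have "fps_deriv (u ^ (2 * n + 1)) = - (fps_const (of_nat (2 * n + 1)) * u ^ (2 * n))"
    unfolding fps_deriv_power by (simp add: u_def del: fps_const_neg)
  then have D: "fps_deriv (u ^ (2 * n + 1) * A)
      = u ^ (2 * n + 1) * fps_deriv A - fps_const (of_nat (2 * n + 1)) * u ^ (2 * n) * A"
    unfolding fps_deriv_mult by simp
  have "euler2_fps (Suc n) = u ^ (2 * n + 2) * (fps_X * fps_deriv A)"
    unfolding euler2_fps_Suc Suc.IH u_def [symmetric] A_def [symmetric] D
    by (simp add: algebra_simps)
  also have "\<dots> = u ^ (2 * Suc n + 1) * stirling2_diag_fps (Suc n)"
    unfolding A_def stirling2_diag_fps_Suc [symmetric] u_def by (simp add: mult.assoc)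
  finally show ?case by (simp add: u_def)
qed

corollary euler2_fps_Suc_eq:
  "euler2_fps (Suc n) = (1 - fps_X) ^ (2 * Suc n) * (fps_X * fps_deriv (stirling2_diag_fps n))"
  unfolding euler2_fps_eq stirling2_diag_fps_Suc [symmetric] by (simp add: mult.assoc)

lemma one_minus_fps_X_power_nth:
  "((1 - fps_X) ^ N :: 'a :: comm_ring_1 fps) $ j = (- 1) ^ j * of_nat (N choose j)"
proof (induction N arbitrary: j)
  case 0
  then show ?case by (cases j) simp_all
next
  case (Suc N)
  then show ?case by (cases j) (simp_all add: left_diff_distrib algebra_simps)
qed

lemma one_minus_fps_X_power_mult_nth:
  "((1 - fps_X) ^ N * f :: 'a :: comm_ring_1 fps) $ m
     = (\<Sum>k=0..m. (- 1) ^ (m - k) * of_nat (N choose (m - k)) * f $ k)"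
  unfolding mult.commute [of "(1 - fps_X) ^ N"] fps_mult_nth
  by (intro sum.cong refl) (simp add: one_minus_fps_X_power_nth mult.commute)

theorem mainTheorem1:
  fixes n m :: nat
  assumes "n \<ge> 1"
  shows "euler2 n (int m) =
           (\<Sum>k=0..m. (-1) ^ (m - k) * int ((2 * n + 1) choose (m - k)) * int (Stirling (n + k) k)) \<and>
         euler2 n (int m) =
           (\<Sum>k=0..m. (-1) ^ (m - k) * int k * int ((2 * n) choose (m - k)) * int (Stirling (n + k - 1) k))"
proof
  have P: "euler2 n (int m) = euler2_fps n $ m"
    by (simp add: euler2_fps_def)
  show "euler2 n (int m) =
      (\<Sum>k=0..m. (-1) ^ (m - k) * int ((2 * n + 1) choose (m - k)) * int (Stirling (n + k) k))"
    unfolding P euler2_fps_eq one_minus_fps_X_power_mult_nth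
    by (simp add: stirling2_diag_fps_def)
  obtain n' where n': "n = Suc n'"
    using assms by (cases n) simp_all
  have nth: "(fps_X * fps_deriv (stirling2_diag_fps n')) $ k
      = int k * int (Stirling (n + k - 1) k)" for k
    by (cases k) (simp_all add: stirling2_diag_fps_def n')
  have "euler2 n (int m) = (\<Sum>k=0..m. (-1) ^ (m - k) * int ((2 * n) choose (m - k))
      * (int k * int (Stirling (n + k - 1) k)))"
    unfolding nth [symmetric] P unfolding n' euler2_fps_Suc_eq one_minus_fps_X_power_mult_nth
    by simp
  then show "euler2 n (int m) =
      (\<Sum>k=0..m. (-1) ^ (m - k) * int k * int ((2 * n) choose (m - k)) * int (Stirling (n + k - 1) k))"
    by (simp add: mult_ac)
qed

end
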